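(* Let $(X,T)$ be a topological dynamical system satisfying the specification property, and let $\mathcal{F}=\{f_n\}_{n\ge1}$ be an asymptotically additive potential on $X$. Let $\Phi=\{\varphi_n\}_{n\ge1}$ be an asymptotically additive potential on $X$ with $\eta(\Phi)<\beta(\Phi)$. Then $$\beta(\mathcal{F})=\sup_{x\in\widehat{X}_\Phi}\limsup_{n\to\infty}\frac1n f_n(x)=\sup\Big\{\mathcal{F}_*(\mu):\mu\in\bigcup_{x\in\widehat{X}_\Phi}\mathcal{V}(x)\Big\}.$$
   Context: $X$ is a compact metric space with metric $d$ and $T:X\to X$ is continuous. $\mathcal{M}_T$ denotes the set of $T$-invariant Borel probability measures on $X$. For $f\in C(X)$, $S_nf=\sum_{i=0}^{n-1}f\circ T^i$. A sequence $\mathcal{F}=\{f_n\}_{n\ge1}\subset C(X)$ is an asymptotically additive potential (AAP) if for every $\xi>0$ there is $f_\xi\in C(X)$ with $\limsup_{n\to\infty}\frac1n\|f_n-S_nf_\xi\|_\infty<\xi$; for $\mu\in\mathcal{M}_T$, $\mathcal{F}_*(\mu)=\lim_{n\to\infty}\frac1n\int f_n\,d\mu$ (this limit exists). $\beta(\mathcal{F})=\max_{\mu\in\mathcal{M}_T}\mathcal{F}_*(\mu)$, $\eta(\Phi)=\min_{\mu\in\mathcal{M}_T}\Phi_*(\mu)$. The irregular set is $\widehat{X}_\Phi=\{x\in X:\lim_{n\to\infty}\frac1n\varphi_n(x)\text{ does not exist}\}$. For $x\in X$, $\mathcal{V}(x)$ is the set of weak$^*$ limit points of $\delta_{x,n}=\frac1n\sum_{i=0}^{n-1}\delta_{T^ix}$.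 $(X,T)$ has the specification property if for every $\epsilon>0$ there is an integer $m(\epsilon)$ such that for any finite collection of intervals $[a_j,b_j]\subset\mathbb{N}$, $j=1,\dots,k$, with $a_{j+1}-b_j\ge m(\epsilon)$ for $j=1,\dots,k-1$, and any $x_1,\dots,x_k\in X$, there is $x\in X$ with $d(T^{p+a_j}x,T^px_j)<\epsilon$ for all $p=0,1,\dots,b_j-a_j$ and all $j$. *)

theory Defs
  imports "HOL-Analysis.Analysis" "HOL-Probability.Probability"
begin

definition birkhoff_sum :: "('a \<Rightarrow> 'a) \<Rightarrow> nat \<Rightarrow> ('a \<Rightarrow> real) \<Rightarrow> 'a \<Rightarrow> real" where
  "birkhoff_sum T n g x = (\<Sum>i<n. g ((T ^^ i) x))"

definition borel_prob :: "'a::metric_space set \<Rightarrow> 'a measure \<Rightarrow> bool" where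
  "borel_prob X M \<longleftrightarrow> prob_space M \<and> sets M = sets (restrict_space borel X)"

definition inv_measures :: "'a::metric_space set \<Rightarrow> ('a \<Rightarrow> 'a) \<Rightarrow> 'a measure set" where
  "inv_measures X T = {M. borel_prob X M \<and>
      (\<forall>A \<in> sets M. emeasure M (T -` A \<inter> X) = emeasure M A)}"

text \<open>Asymptotically additive potential (indices n \<ge> 1; the value at 0 is irrelevant).\<close>
definition AAP :: "'a::metric_space set \<Rightarrow> ('a \<Rightarrow> 'a) \<Rightarrow> (nat \<Rightarrow> 'a \<Rightarrow> real) \<Rightarrow> bool" where
  "AAP X T F \<longleftrightarrow> (\<forall>n\<ge>1. continuous_on X (F n)) \<and>
     (\<forall>\<xi>>0. \<exists>g. continuous_on X g \<and>
        limsup (\<lambda>n. ereal ((1 / real n) * (SUP x\<in>X. \<bar>F n x - birkhoff_sum T n g x\<bar>))) < ereal \<xi>)"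

definition Fstar :: "(nat \<Rightarrow> 'a \<Rightarrow> real) \<Rightarrow> 'a measure \<Rightarrow> real" where
  "Fstar F M = lim (\<lambda>n. (1 / real n) * integral\<^sup>L M (F n))"

text \<open>beta(F) = max over invariant measures (written as a supremum in ereal), eta = min.\<close>
definition beta :: "'a::metric_space set \<Rightarrow> ('a \<Rightarrow> 'a) \<Rightarrow> (nat \<Rightarrow> 'a \<Rightarrow> real) \<Rightarrow> ereal" where
  "beta X T F = (SUP M \<in> inv_measures X T. ereal (Fstar F M))"

definition eta :: "'a::metric_space set \<Rightarrow> ('a \<Rightarrow> 'a) \<Rightarrow> (nat \<Rightarrow> 'a \<Rightarrow> real) \<Rightarrow> ereal" where
  "eta X T F = (INF M \<in> inv_measures X T. ereal (Fstar F M))"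

definition irregular_set :: "'a set \<Rightarrow> (nat \<Rightarrow> 'a \<Rightarrow> real) \<Rightarrow> 'a set" where
  "irregular_set X Phi = {x \<in> X. \<not> convergent (\<lambda>n. Phi n x / real n)}"

text \<open>V(x): weak-* limit points of the empirical measures delta_{x,n}, i.e. Borel probability
  measures on X that are limits of some subsequence of the empirical measures.\<close>
definition emp_limits :: "'a::metric_space set \<Rightarrow> ('a \<Rightarrow> 'a) \<Rightarrow> 'a \<Rightarrow> 'a measure set" where
  "emp_limits X T x = {M. borel_prob X M \<and> (\<exists>r::nat \<Rightarrow> nat. strict_mono r \<and>
      (\<forall>g. continuous_on X g \<longrightarrow>
         (\<lambda>k. (1 / real (r k)) * birkhoff_sum T (r k) g x) \<longlonglongrightarrow> integral\<^sup>L M g))}"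

definition spec_property :: "'a::metric_space set \<Rightarrow> ('a \<Rightarrow> 'a) \<Rightarrow> bool" where
  "spec_property X T \<longleftrightarrow> (\<forall>\<epsilon>>0. \<exists>m::nat. \<forall>(k::nat) (a::nat \<Rightarrow> nat) (b::nat \<Rightarrow> nat) xs.
      k \<ge> 1 \<and> (\<forall>j<k. a j \<le> b j) \<and>
      (\<forall>j. Suc j < k \<longrightarrow> int (a (Suc j)) - int (b j) \<ge> int m) \<and>
      (\<forall>j<k. xs j \<in> X) \<longrightarrow>
      (\<exists>x\<in>X. \<forall>j<k. \<forall>p\<le>b j - a j. dist ((T ^^ (p + a j)) x) ((T ^^ p) (xs j)) < \<epsilon>))"

end

theory Submission
  imports Defs
begin

text \<open>The upper limit of \<open>F n x / n\<close> at a point \<open>x\<close> is attained as \<open>Fstar F M\<close> for some limit point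
  \<open>M\<close> of the empirical measures of \<open>x\<close>, and all such limit points are invariant. Hence the pointwise
  supremum is at most the supremum over limit measures, which is at most \<open>beta\<close>. To close the cycle,
  pick invariant measures with different values of \<open>Phi\<close> and one almost realising \<open>beta\<close> of \<open>F\<close>.
  Since an integral is at most the supremum of the integrand, for all large \<open>n\<close> there are points
  whose \<open>n\<close>-step averages are about as extreme as these values; no ergodicity is involved. By
  specification and compactness one orbit shadows such segments cyclically with a fixed precision,
  each segment so long that everything before it is negligible. Its averages of \<open>Phi\<close> oscillate,
  and its averages of \<open>F\<close> come close to \<open>beta\<close> infinitely often.\<close>

section \<open>Compact metric spaces as continuous images of compact sets of reals\<close>

text \<open>The term of index \<open>n\<close> has size \<open>1 / 4 ^ n\<close>, and all later
  terms together at most a third of that. In base 2 the tail could cancel the leading term.\<close>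

lemma suminf_quaternary_lower_bound:
  fixes c :: "nat \<Rightarrow> real"
  assumes bound: "\<And>k. \<bar>c k\<bar> \<le> 1" and zero: "\<And>k. k < n \<Longrightarrow> c k = 0" and n: "\<bar>c n\<bar> = 1"
  shows "\<bar>\<Sum>k. c k / 4 ^ k\<bar> \<ge> 2 / 3 / 4 ^ n"
proof -
  have geo: "(\<lambda>k. (1/4 :: real) ^ k) sums (4/3)"
    using geometric_sums[of "1/4::real"] by simp
  have tail_geo: "(\<lambda>k. 1 / 4 ^ (k + Suc n) :: real) sums (1 / 3 / 4 ^ n)"
    using sums_mult2[OF geo, of "1 / 4 ^ Suc n"] by (simp add: power_add power_one_over field_simps)
  have summable: "summable (\<lambda>k. c k / 4 ^ k)"
    by (rule summable_comparison_test'[OF sums_summable[OF geo], of 0])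
       (use bound in \<open>auto simp: power_one_over divide_simps\<close>)
  have "(\<Sum>k. c k / 4 ^ k) = (\<Sum>k. c (k + Suc n) / 4 ^ (k + Suc n)) + (\<Sum>k<Suc n. c k / 4 ^ k)"
    by (rule suminf_split_initial_segment[OF summable])
  also have "(\<Sum>k<Suc n. c k / 4 ^ k) = c n / 4 ^ n"
    using zero by simp
  finally have split: "(\<Sum>k. c k / 4 ^ k) = (\<Sum>k. c (k + Suc n) / 4 ^ (k + Suc n)) + c n / 4 ^ n" .
  have le: "norm (c (k + Suc n) / 4 ^ (k + Suc n)) \<le> 1 / 4 ^ (k + Suc n)" for k
    using bound[of "k + Suc n"] by (simp add: divide_right_mono)
  have "norm (\<Sum>k. c (k + Suc n) / 4 ^ (k + Suc n)) \<le> (\<Sum>k. 1 / 4 ^ (k + Suc n))"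
    by (rule norm_suminf_le[OF le sums_summable[OF tail_geo]])
  also have "\<dots> = 1 / 3 / 4 ^ n"
    using sums_unique[OF tail_geo] by simp
  finally have "\<bar>\<Sum>k. c (k + Suc n) / 4 ^ (k + Suc n)\<bar> \<le> 1 / 3 / 4 ^ n" by simp
  moreover have "\<bar>c n / 4 ^ n\<bar> = 1 / 4 ^ n" using n by simp
  ultimately show ?thesis
    unfolding split
    using abs_triangle_ineq2[of "c n / 4 ^ n" "- (\<Sum>k. c (k + Suc n) / 4 ^ (k + Suc n))"]
    by (simp add: add.commute)
qed

text \<open>The sets are the balls of radius \<open>1 / Suc n\<close> around finite nets, listed in
  one sequence. Points in the same ball of a net are less than \<open>2 / Suc n\<close> apart, and
  the finitely many balls of one net all occur up to some index.\<close>

lemma compact_separating_sequence: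
  fixes X :: "'a::metric_space set"
  assumes "compact X" "X \<noteq> {}"
  obtains U :: "nat \<Rightarrow> 'a set"
  where "\<And>e. e > 0 \<Longrightarrow>
    \<exists>N. \<forall>y\<in>X. \<forall>z\<in>X. (\<forall>k\<le>N. y \<in> U k \<longleftrightarrow> z \<in> U k) \<longrightarrow> dist y z < e"
proof -
  have "\<exists>K. finite K \<and> K \<subseteq> X \<and> X \<subseteq> (\<Union>c\<in>K. ball c (1 / Suc n))" for n
    using compact_imp_seq_compact[OF assms(1)] seq_compact_imp_totally_bounded[of X]
    by (meson of_nat_0_less_iff zero_less_Suc zero_less_divide_1_iff)
  then obtain K where K: "\<And>n. finite (K n)" "\<And>n. X \<subseteq> (\<Union>c\<in>K n. ball c (1 / Suc n))"
    by metis
  define I where "I = Sigma UNIV K"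
  have "countable I" unfolding I_def
    by (intro countable_SIGMA) (auto intro: countable_finite K)
  have "K 0 \<noteq> {}" using K(2)[of 0] assms(2) by auto
  then have "I \<noteq> {}" unfolding I_def by auto
  define U where "U k = (case from_nat_into I k of (n, c) \<Rightarrow> ball c (1 / Suc n))" for k
  show thesis
  proof
    fix e :: real assume "e > 0"
    then obtain n where n: "1 / Suc n < e / 2"
      by (metis half_gt_zero nat_approx_posE)
    define N where "N = Max ((\<lambda>c. to_nat_on I (n, c)) ` K n)"
    have "dist y z < e" if y: "y \<in> X" and z: "z \<in> X"
      and same: "\<forall>k\<le>N. y \<in> U k \<longleftrightarrow> z \<in> U k" for y z
    proof -
      obtain c where c: "c \<in> K n" "y \<in> ball c (1 / Suc n)" using K(2)[of n] y by auto
      define k where "k = to_nat_on I (n, c)"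
      have "k \<le> N" unfolding N_def k_def using K(1) c(1) by (intro Max_ge) auto
      have "(n, c) \<in> I" using c(1) by (auto simp: I_def)
      then have "U k = ball c (1 / Suc n)"
        unfolding U_def k_def by (simp add: \<open>countable I\<close>)
      then have "z \<in> ball c (1 / Suc n)" using same \<open>k \<le> N\<close> c(2) by auto
      then show ?thesis using c(2) n dist_triangle[of y z c] by (simp add: dist_commute)
    qed
    then show "\<exists>N. \<forall>y\<in>X. \<forall>z\<in>X. (\<forall>k\<le>N. y \<in> U k \<longleftrightarrow> z \<in> U k) \<longrightarrow> dist y z < e"
      by blast
  qed
qed

text \<open>The base 4 digits of \<open>s y\<close> record membership in the separating sets. Codes
  close enough share their leading digits, so the points are close. The code itself need not be
  continuous; only its inverse is controlled.\<close>

lemma compact_real_coding: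
  fixes X :: "'a::metric_space set"
  assumes "compact X" "X \<noteq> {}"
  obtains s :: "'a \<Rightarrow> real"
  where "\<And>y. s y \<in> {0..2}"
    and "\<And>e. e > 0 \<Longrightarrow> \<exists>d>0. \<forall>y\<in>X. \<forall>z\<in>X. \<bar>s y - s z\<bar> < d \<longrightarrow> dist y z < e"
proof -
  obtain U :: "nat \<Rightarrow> 'a set" where U: "\<And>e. e > 0 \<Longrightarrow>
    \<exists>N. \<forall>y\<in>X. \<forall>z\<in>X. (\<forall>k\<le>N. y \<in> U k \<longleftrightarrow> z \<in> U k) \<longrightarrow> dist y z < e"
    using compact_separating_sequence[OF assms] by metis
  define b :: "'a \<Rightarrow> nat \<Rightarrow> real" where "b y k = indicator (U k) y" for y k
  have b: "0 \<le> b y k" "b y k \<le> 1" for y k by (auto simp: b_def indicator_def)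
  define s where "s y = (\<Sum>k. b y k / 4 ^ k)" for y
  have geo: "(\<lambda>k. (1/4 :: real) ^ k) sums (4/3)"
    using geometric_sums[of "1/4::real"] by simp
  have le: "b y k / 4 ^ k \<le> (1/4) ^ k" for y k
    using b(2)[of y k] by (simp add: power_one_over divide_simps)
  have summable: "summable (\<lambda>k. b y k / 4 ^ k)" for y
    by (rule summable_comparison_test'[OF sums_summable[OF geo], of 0])
       (use le b(1) in auto)
  show thesis
  proof
    fix y
    have "s y \<le> 4/3"
      unfolding s_def sums_unique[OF geo] by (intro suminf_le le summable sums_summable[OF geo])
    moreover have "0 \<le> s y"
      unfolding s_def by (intro suminf_nonneg summable) (simp add: b)
    ultimately show "s y \<in> {0..2}" by simp
  next
    fix e :: real assume "e > 0"
    then obtain N where N: "\<And>y z. y \<in> X \<Longrightarrow> z \<in> X \<Longrightarrow> \<forall>k\<le>N. y \<in> U k \<longleftrightarrow> z \<in> U k \<Longrightarrow> dist y z < e"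
      using U by metis
    \<comment> \<open>The threshold bounds from below the distance of two codes that first differ at
      an index up to \<open>N\<close>.\<close>
    have "dist y z < e" if y: "y \<in> X" and z: "z \<in> X" and d: "\<bar>s y - s z\<bar> < 2 / 3 / 4 ^ N" for y z
    proof (rule N[OF y z], rule ccontr)
      assume neq: "\<not> (\<forall>k\<le>N. (y \<in> U k) = (z \<in> U k))"
      then have ex: "\<exists>k. (y \<in> U k) \<noteq> (z \<in> U k)" by blast
      define n where "n = (LEAST k. (y \<in> U k) \<noteq> (z \<in> U k))"
      have n: "(y \<in> U n) \<noteq> (z \<in> U n)" unfolding n_def by (rule LeastI_ex[OF ex])
      have less: "(y \<in> U k) = (z \<in> U k)" if "k < n" for k
        using not_less_Least that unfolding n_def by blast
      have "n \<le> N"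
      proof (rule ccontr)
        assume "\<not> n \<le> N"
        then have "\<forall>k\<le>N. (y \<in> U k) = (z \<in> U k)" using less by simp
        then show False using neq by blast
      qed
      have "2 / 3 / 4 ^ n \<le> \<bar>\<Sum>k. (b y k - b z k) / 4 ^ k\<bar>"
        by (rule suminf_quaternary_lower_bound)
           (use n less in \<open>auto simp: b_def indicator_def\<close>)
      also have "(\<Sum>k. (b y k - b z k) / 4 ^ k) = s y - s z"
        unfolding s_def diff_divide_distrib by (rule suminf_diff[symmetric]) (rule summable)+
      finally have "2 / 3 / 4 ^ n \<le> \<bar>s y - s z\<bar>" .
      moreover have "2 / 3 / 4 ^ N \<le> (2 / 3 / 4 ^ n :: real)"
        using \<open>n \<le> N\<close> by (simp add: divide_simps)
      ultimately show False using d by linarith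
    qed
    then show "\<exists>d>0. \<forall>y\<in>X. \<forall>z\<in>X. \<bar>s y - s z\<bar> < d \<longrightarrow> dist y z < e"
      by (intro exI[of _ "2 / 3 / 4 ^ N"]) auto
  qed
qed

text \<open>The inverse of the coding map is uniformly continuous, so the closure of the (swapped) graph
  is again the graph of a function of the code.\<close>

lemma compact_metric_continuous_image_of_compact_real:
  fixes X :: "'a::metric_space set"
  assumes "compact X" "X \<noteq> {}"
  obtains K :: "real set" and p :: "real \<Rightarrow> 'a" and s :: "'a \<Rightarrow> real"
  where "compact K" "continuous_on K p" "p ` K \<subseteq> X"
    "\<And>y. y \<in> X \<Longrightarrow> s y \<in> K" "\<And>y. y \<in> X \<Longrightarrow> p (s y) = y"
proof -
  obtain s :: "'a \<Rightarrow> real" where s: "\<And>y. s y \<in> {0..2}"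
    and sep: "\<And>e. e > 0 \<Longrightarrow> \<exists>d>0. \<forall>y\<in>X. \<forall>z\<in>X. \<bar>s y - s z\<bar> < d \<longrightarrow> dist y z < e"
    using compact_real_coding[OF assms] by metis
  define G where "G = closure ((\<lambda>y. (s y, y)) ` X)"
  have box: "compact ({0..2::real} \<times> X)" by (intro compact_Times assms) auto
  have G_box: "G \<subseteq> {0..2} \<times> X"
    unfolding G_def by (intro closure_minimal compact_imp_closed box) (use s in auto)
  have "compact G"
    using compact_Int_closed[OF box, of G] G_box by (simp add: G_def Int_absorb1)
  have inj: "y = y'" if in_G: "(t, y) \<in> G" "(t, y') \<in> G" for t y y'
  proof (rule ccontr)
    assume "y \<noteq> y'"
    \<comment> \<open>The three thirds pay for the way from \<open>y\<close> over \<open>z\<close>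
      and \<open>z'\<close> to \<open>y'\<close>, where \<open>z\<close> and \<open>z'\<close> are
      points of \<open>X\<close> with codes near \<open>t\<close>.\<close>
    define e where "e = dist y y' / 3"
    have "e > 0" using \<open>y \<noteq> y'\<close> by (simp add: e_def)
    then obtain d where d: "d > 0" "\<And>y z. y \<in> X \<Longrightarrow> z \<in> X \<Longrightarrow> \<bar>s y - s z\<bar> < d \<Longrightarrow> dist y z < e"
      using sep by metis
    have approx: "\<exists>z\<in>X. \<bar>s z - t\<bar> < d / 2 \<and> dist z w < e" if tw: "(t, w) \<in> G" for w
    proof -
      have "min (d/2) e > 0" using \<open>d > 0\<close> \<open>e > 0\<close> by simp
      then obtain z where z: "z \<in> X" "dist (s z, z) (t, w) < min (d/2) e"
        using tw unfolding G_def closure_approachable by blast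
      have "dist (s z) t < min (d/2) e" "dist z w < min (d/2) e"
        using z(2) dist_fst_le[of "(s z, z)" "(t, w)"] dist_snd_le[of "(s z, z)" "(t, w)"] by auto
      then show ?thesis using z(1) by (auto simp: dist_real_def)
    qed
    obtain z where z: "z \<in> X" "\<bar>s z - t\<bar> < d / 2" "dist z y < e"
      using approx[OF in_G(1)] by blast
    obtain z' where z': "z' \<in> X" "\<bar>s z' - t\<bar> < d / 2" "dist z' y' < e"
      using approx[OF in_G(2)] by blast
    have "\<bar>s z - s z'\<bar> < d" using z(2) z'(2) by linarith
    then have "dist z z' < e" by (rule d(2)[OF z(1) z'(1)])
    then have "dist y y' < 3 * e"
      using z(3) z'(3) dist_triangle[of y y' z] dist_triangle[of z y' z'] dist_commute[of y z]
      by linarith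
    then show False by (simp add: e_def)
  qed
  have "inj_on fst G"
  proof (rule inj_onI)
    fix u v assume "u \<in> G" "v \<in> G" "fst u = fst v"
    then show "u = v" by (cases u; cases v) (auto intro: inj)
  qed
  define q where "q = inv_into G fst"
  have q: "q (fst w) = w" if "w \<in> G" for w
    unfolding q_def using \<open>inj_on fst G\<close> that by simp
  have snd_q: "snd (q (fst w)) \<in> X" if "w \<in> G" for w
    using G_box that by (auto simp: q[OF that])
  have "continuous_on (fst ` G) q"
    by (rule continuous_on_inv[OF continuous_on_fst[OF continuous_on_id] \<open>compact G\<close>]) (simp add: q)
  have mem: "(s y, y) \<in> G" if "y \<in> X" for y
    unfolding G_def by (rule subsetD[OF closure_subset]) (use that in auto)
  show thesis
  proof
    show "compact (fst ` G)"
      by (intro compact_continuous_image \<open>compact G\<close> continuous_intros)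
    show "continuous_on (fst ` G) (\<lambda>t. snd (q t))"
      by (intro continuous_intros \<open>continuous_on (fst ` G) q\<close>)
    show "(\<lambda>t. snd (q t)) ` fst ` G \<subseteq> X" using snd_q by blast
    show "s y \<in> fst ` G" if "y \<in> X" for y using imageI[OF mem[OF that], of fst] by simp
    show "snd (q (s y)) = y" if "y \<in> X" for y using q[OF mem[OF that]] by simp
  qed
qed

section \<open>Integrals of continuous functions\<close>

lemma borel_prob_prob_space: "borel_prob X M \<Longrightarrow> prob_space M"
  by (simp add: borel_prob_def)

lemma borel_prob_sets: "borel_prob X M \<Longrightarrow> sets M = sets (restrict_space borel X)"
  by (simp add: borel_prob_def)

lemma borel_prob_space: "borel_prob X M \<Longrightarrow> space M = X"
  using sets_eq_imp_space_eq[of M "restrict_space borel X"]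
  by (simp add: borel_prob_def space_restrict_space)

lemma borel_prob_measurable:
  fixes g :: "'a::metric_space \<Rightarrow> 'b::topological_space"
  assumes "borel_prob X M" "continuous_on X g"
  shows "g \<in> borel_measurable M"
  using borel_measurable_continuous_on_restrict[OF assms(2)]
    measurable_cong_sets[OF borel_prob_sets[OF assms(1)] refl] by blast

lemma compact_continuous_bound:
  fixes g :: "'a::metric_space \<Rightarrow> real"
  assumes "compact X" "continuous_on X g"
  obtains B where "B \<ge> 0" "\<And>x. x \<in> X \<Longrightarrow> \<bar>g x\<bar> \<le> B"
proof -
  have "bounded (g ` X)"
    by (intro compact_imp_bounded compact_continuous_image assms)
  then obtain B where "B > 0" "\<forall>y\<in>g ` X. norm y \<le> B" using bounded_pos by blast
  then show thesis using that[of B] by auto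
qed

lemma borel_prob_integrable:
  fixes g :: "'a::metric_space \<Rightarrow> real"
  assumes "compact X" "borel_prob X M" "continuous_on X g"
  shows "integrable M g"
proof -
  interpret prob_space M by (rule borel_prob_prob_space) fact
  obtain B where "\<And>x. x \<in> X \<Longrightarrow> \<bar>g x\<bar> \<le> B"
    using compact_continuous_bound[OF assms(1,3)] by metis
  then show ?thesis
    using borel_prob_space[OF assms(2)] borel_prob_measurable[OF assms(2,3)]
    by (intro integrable_const_bound[of _ B]) auto
qed

lemma borel_prob_integral_diff_le:
  fixes g h :: "'a::metric_space \<Rightarrow> real"
  assumes "compact X" "borel_prob X M" "continuous_on X g" "continuous_on X h"
    and le: "\<And>x. x \<in> X \<Longrightarrow> \<bar>g x - h x\<bar> \<le> \<xi>"
  shows "\<bar>integral\<^sup>L M g - integral\<^sup>L M h\<bar> \<le> \<xi>"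
proof -
  interpret prob_space M by (rule borel_prob_prob_space) fact
  note int = borel_prob_integrable[OF assms(1,2,3)] borel_prob_integrable[OF assms(1,2,4)]
  have "\<bar>integral\<^sup>L M g - integral\<^sup>L M h\<bar> = \<bar>\<integral>x. g x - h x \<partial>M\<bar>"
    using int by simp
  also have "\<dots> \<le> (\<integral>x. \<bar>g x - h x\<bar> \<partial>M)" by simp
  also have "\<dots> \<le> \<xi>"
    by (rule integral_le_const)
       (use int le borel_prob_space[OF assms(2)] in \<open>auto intro!: Bochner_Integration.integrable_diff\<close>)
  finally show ?thesis .
qed

lemma borel_prob_integral_less_point:
  fixes g :: "'a::metric_space \<Rightarrow> real"
  assumes "compact X" "borel_prob X M" "continuous_on X g" "c < integral\<^sup>L M g"
  obtains x where "x \<in> X" "c < g x"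
proof -
  interpret prob_space M by (rule borel_prob_prob_space) fact
  have "\<exists>x\<in>X. c < g x"
  proof (rule ccontr)
    assume "\<not> (\<exists>x\<in>X. c < g x)"
    then have "integral\<^sup>L M g \<le> c"
      using borel_prob_space[OF assms(2)] borel_prob_integrable[OF assms(1-3)]
      by (intro integral_le_const) (auto simp: not_less)
    then show False using assms(4) by simp
  qed
  then show thesis using that by blast
qed

section \<open>Integrals of continuous functions determine a Borel probability measure\<close>

lemma sets_restrict_borel_closed:
  assumes "closed X"
  shows "sets (restrict_space borel X) = sigma_sets X ((\<inter>) X ` Collect closed)"
proof -
  have "sets borel = sigma_sets UNIV (Collect (closed :: 'a set \<Rightarrow> bool))"
    by (simp add: borel_eq_closed)
  then show ?thesis
    unfolding sets_restrict_space using assms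
    by (subst sigma_sets_Int[symmetric]) auto
qed

text \<open>The functions are 1 on \<open>C\<close> and 0 at distance \<open>1 / n\<close> or more
  from it. The empty set is excluded because \<open>infdist x {}\<close> is 0, which would make them
  constantly 1.\<close>

lemma tendsto_closed_indicator:
  fixes C :: "'a::metric_space set"
  assumes "closed C" "C \<noteq> {}"
  shows "(\<lambda>n. max 0 (1 - real n * infdist x C)) \<longlonglongrightarrow> indicator C x"
proof (cases "x \<in> C")
  case True
  then show ?thesis using assms by simp
next
  case False
  then have "infdist x C > 0" using assms by (intro infdist_pos_not_in_closed) auto
  then obtain N where N: "1 < real N * infdist x C" using reals_Archimedean3 by blast
  have "max 0 (1 - real n * infdist x C) = 0" if "n \<ge> N" for n
  proof -
    have "real N * infdist x C \<le> real n * infdist x C"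
      using that infdist_nonneg by (intro mult_right_mono) auto
    then show ?thesis using N by simp
  qed
  then show ?thesis using False
    by (intro tendsto_eventually eventually_sequentiallyI[of N]) auto
qed

text \<open>Dominated convergence along continuous approximations of indicators gives equal masses
  to the traces of closed sets on \<open>X\<close>. These are stable under intersection and generate
  the sigma-algebra.\<close>

lemma borel_prob_eqI:
  assumes "compact X" and M: "borel_prob X M" and N: "borel_prob X N"
    and eq: "\<And>g. continuous_on X g \<Longrightarrow> integral\<^sup>L M g = (integral\<^sup>L N g :: real)"
  shows "M = N"
proof -
  have "closed X" using assms(1) by (rule compact_imp_closed)
  have conv: "(\<lambda>n. integral\<^sup>L P (\<lambda>x. max 0 (1 - real n * infdist x C))) \<longlonglongrightarrow> measure P (X \<inter> C)"
    if P: "borel_prob X P" and C: "closed C" "C \<noteq> {}" for P C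
  proof -
    interpret prob_space P by (rule borel_prob_prob_space) fact
    have [measurable]: "(\<lambda>x. max 0 (1 - real n * infdist x C)) \<in> borel_measurable P" for n
      by (rule borel_prob_measurable[OF P]) (intro continuous_intros)
    have meas: "X \<inter> C \<in> sets P"
      unfolding borel_prob_sets[OF P] using C by (auto simp: sets_restrict_space)
    \<comment> \<open>\<open>C\<close> itself need not belong to \<open>sets P\<close>, but on the
      space \<open>X\<close> its indicator agrees with that of \<open>X \<inter> C\<close>.\<close>
    have [measurable]: "(indicator C :: 'a \<Rightarrow> real) \<in> borel_measurable P"
    proof -
      have "(indicator (X \<inter> C) :: 'a \<Rightarrow> real) \<in> borel_measurable P" using meas by simp
      moreover have "(indicator (X \<inter> C) :: 'a \<Rightarrow> real) \<in> borel_measurable P \<longleftrightarrow>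
          (indicator C :: 'a \<Rightarrow> real) \<in> borel_measurable P"
        by (rule measurable_cong) (simp add: borel_prob_space[OF P] indicator_def)
      ultimately show ?thesis by simp
    qed
    have "(\<lambda>n. integral\<^sup>L P (\<lambda>x. max 0 (1 - real n * infdist x C))) \<longlonglongrightarrow> integral\<^sup>L P (indicator C)"
      by (rule integral_dominated_convergence[where w = "\<lambda>_. 1"])
         (auto intro!: tendsto_closed_indicator C simp: infdist_nonneg)
    moreover have "integral\<^sup>L P (indicator C) = (measure P (X \<inter> C) :: real)"
      using borel_prob_space[OF P] by (simp add: Int_commute)
    ultimately show ?thesis by simp
  qed
  have closed_eq: "emeasure M (X \<inter> C) = emeasure N (X \<inter> C)" if C: "closed C" for C
  proof (cases "C = {}")
    case False
    have "measure M (X \<inter> C) = measure N (X \<inter> C)"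
    proof (rule LIMSEQ_unique[OF conv[OF M C False]])
      have "integral\<^sup>L M (\<lambda>x. max 0 (1 - real n * infdist x C)) =
          integral\<^sup>L N (\<lambda>x. max 0 (1 - real n * infdist x C))" for n
        by (rule eq) (intro continuous_intros)
      then show "(\<lambda>n. integral\<^sup>L M (\<lambda>x. max 0 (1 - real n * infdist x C))) \<longlonglongrightarrow> measure N (X \<inter> C)"
        using conv[OF N C False] by simp
    qed
    then show ?thesis
      using borel_prob_prob_space[OF M] borel_prob_prob_space[OF N]
      by (simp add: finite_measure.emeasure_eq_measure prob_space.finite_measure)
  qed simp
  show ?thesis
  proof (rule measure_eqI_generator_eq[where A = "\<lambda>_. X"])
    show "Int_stable ((\<inter>) X ` Collect closed)"
    proof (rule Int_stableI_image)
      fix C D :: "'a set" assume "C \<in> Collect closed" "D \<in> Collect closed"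
      then show "\<exists>E\<in>Collect closed. X \<inter> C \<inter> (X \<inter> D) = X \<inter> E"
        by (intro bexI[of _ "C \<inter> D"]) auto
    qed
    show "range (\<lambda>_. X) \<subseteq> (\<inter>) X ` Collect closed" using \<open>closed X\<close> by auto
    show "emeasure M X \<noteq> \<infinity>"
      using borel_prob_prob_space[OF M]
      by (simp add: finite_measure.emeasure_finite prob_space.finite_measure)
  qed (use closed_eq borel_prob_sets[OF M] borel_prob_sets[OF N]
        sets_restrict_borel_closed[OF \<open>closed X\<close>] in auto)
qed

section \<open>Asymptotically additive potentials and invariant measures\<close>

locale compact_system =
  fixes X :: "'a::metric_space set" and T :: "'a \<Rightarrow> 'a"
  assumes compact: "compact X" and nonempty: "X \<noteq> {}"
    and maps: "T ` X \<subseteq> X" and cont: "continuous_on X T"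
begin

lemma funpow_in: "x \<in> X \<Longrightarrow> (T ^^ i) x \<in> X"
  using maps by (induction i) auto

lemma continuous_on_funpow: "continuous_on X (T ^^ i)"
proof (induction i)
  case (Suc i)
  have "continuous_on X (T \<circ> (T ^^ i))"
    by (rule continuous_on_compose[OF Suc continuous_on_subset[OF cont]]) (use funpow_in in auto)
  then show ?case by simp
qed (simp add: id_def)

lemma continuous_on_compose_funpow:
  "continuous_on X g \<Longrightarrow> continuous_on X (\<lambda>x. g ((T ^^ i) x))"
  by (rule continuous_on_compose2[OF _ continuous_on_funpow]) (use funpow_in in auto)

lemma continuous_on_birkhoff_sum:
  "continuous_on X g \<Longrightarrow> continuous_on X (birkhoff_sum T n g)"
  unfolding birkhoff_sum_def by (intro continuous_on_sum continuous_on_compose_funpow)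

lemma measurable_map:
  assumes "borel_prob X M"
  shows "T \<in> measurable M M"
proof -
  have "T \<in> measurable M (restrict_space borel X)"
    using borel_prob_measurable[OF assms cont] maps borel_prob_space[OF assms]
    by (intro measurable_restrict_space2) auto
  then show ?thesis
    using measurable_cong_sets[OF refl borel_prob_sets[OF assms]] by blast
qed

text \<open>As a fixed point property of the push-forward, invariance can be used in changes of
  variables and proved by comparing integrals.\<close>

lemma inv_measures_iff: "M \<in> inv_measures X T \<longleftrightarrow> borel_prob X M \<and> distr M M T = M"
proof (cases "borel_prob X M")
  case True
  have "distr M M T = M \<longleftrightarrow> (\<forall>A\<in>sets M. emeasure M (T -` A \<inter> X) = emeasure M A)"
  proof
    assume inv: "distr M M T = M"
    have "emeasure (distr M M T) A = emeasure M (T -` A \<inter> X)" if "A \<in> sets M" for A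
      using emeasure_distr[OF measurable_map[OF True] that] borel_prob_space[OF True] by simp
    then show "\<forall>A\<in>sets M. emeasure M (T -` A \<inter> X) = emeasure M A"
      unfolding inv by simp
  next
    assume "\<forall>A\<in>sets M. emeasure M (T -` A \<inter> X) = emeasure M A"
    then show "distr M M T = M"
      using borel_prob_space[OF True]
      by (intro measure_eqI) (simp_all add: emeasure_distr[OF measurable_map[OF True]])
  qed
  then show ?thesis using True by (simp add: inv_measures_def)
qed (simp add: inv_measures_def)

lemma integral_compose_map:
  fixes g :: "'a \<Rightarrow> real"
  assumes "borel_prob X M" "continuous_on X g"
  shows "integral\<^sup>L (distr M M T) g = (\<integral>x. g (T x) \<partial>M)"
  by (rule integral_distr[OF measurable_map[OF assms(1)] borel_prob_measurable[OF assms]])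

lemma integral_compose_funpow:
  fixes g :: "'a \<Rightarrow> real"
  assumes "M \<in> inv_measures X T" "continuous_on X g"
  shows "(\<integral>x. g ((T ^^ i) x) \<partial>M) = integral\<^sup>L M g"
proof (induction i)
  case (Suc i)
  have M: "borel_prob X M" "distr M M T = M" using assms(1) by (auto simp: inv_measures_iff)
  have "(\<integral>x. g ((T ^^ Suc i) x) \<partial>M) = integral\<^sup>L (distr M M T) (\<lambda>x. g ((T ^^ i) x))"
    by (subst integral_compose_map[OF M(1) continuous_on_compose_funpow[OF assms(2)]])
       (simp add: funpow_swap1)
  then show ?case using Suc M(2) by simp
qed simp

lemma integral_birkhoff_sum:
  fixes g :: "'a \<Rightarrow> real"
  assumes "M \<in> inv_measures X T" "continuous_on X g"
  shows "integral\<^sup>L M (birkhoff_sum T n g) = n * integral\<^sup>L M g"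
proof -
  have M: "borel_prob X M" using assms(1) by (simp add: inv_measures_iff)
  have "integral\<^sup>L M (birkhoff_sum T n g) = (\<Sum>i<n. \<integral>x. g ((T ^^ i) x) \<partial>M)"
    unfolding birkhoff_sum_def
    by (intro Bochner_Integration.integral_sum borel_prob_integrable[OF compact M]
        continuous_on_compose_funpow assms(2))
  then show ?thesis using integral_compose_funpow[OF assms] by simp
qed

section \<open>Uniform approximation of asymptotically additive potentials by Birkhoff sums\<close>

lemma AAP_uniform_approx:
  assumes "AAP X T F" "\<xi> > 0"
  obtains g N where "continuous_on X g"
    "\<And>n x. n \<ge> N \<Longrightarrow> x \<in> X \<Longrightarrow> n > 0 \<and> \<bar>F n x / n - birkhoff_sum T n g x / n\<bar> \<le> \<xi>"
proof -
  let ?sup = "\<lambda>n g. SUP x\<in>X. \<bar>F n x - birkhoff_sum T n g x\<bar>"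
  obtain g where g: "continuous_on X g"
    and "limsup (\<lambda>n. ereal ((1 / real n) * ?sup n g)) < ereal \<xi>"
    using assms unfolding AAP_def by blast
  then have "eventually (\<lambda>n. ereal ((1 / real n) * ?sup n g) < ereal \<xi>) sequentially"
    by (intro Limsup_lessD)
  then obtain N where N: "\<And>n. n \<ge> N \<Longrightarrow> 1 / real n * ?sup n g < \<xi>"
    unfolding eventually_sequentially by auto
  show thesis
  proof (rule that[OF g, of "max N 1"])
    fix n x assume n: "max N 1 \<le> n" and x: "x \<in> X"
    \<comment> \<open>A real supremum bounds its members only for sets bounded above; compactness
      provides this. \<open>max N 1\<close> keeps \<open>n\<close> where \<open>F n\<close> is
      continuous and division by \<open>n\<close> is meaningful.\<close>
    have "continuous_on X (\<lambda>x. \<bar>F n x - birkhoff_sum T n g x\<bar>)"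
      using assms(1) n unfolding AAP_def
      by (intro continuous_intros continuous_on_birkhoff_sum g) auto
    then have "bdd_above ((\<lambda>x. \<bar>F n x - birkhoff_sum T n g x\<bar>) ` X)"
      by (intro bounded_imp_bdd_above compact_imp_bounded compact_continuous_image compact)
    then have "\<bar>F n x - birkhoff_sum T n g x\<bar> \<le> ?sup n g"
      by (rule cSUP_upper[OF x])
    also have "\<dots> \<le> \<xi> * n" using N[of n] n by (simp add: divide_simps)
    finally have "\<bar>F n x - birkhoff_sum T n g x\<bar> \<le> \<xi> * n" .
    moreover have "\<bar>F n x / n - birkhoff_sum T n g x / n\<bar> = \<bar>F n x - birkhoff_sum T n g x\<bar> / n"
      by (simp add: diff_divide_distrib[symmetric])
    ultimately show "n > 0 \<and> \<bar>F n x / n - birkhoff_sum T n g x / n\<bar> \<le> \<xi>"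
      using n by (simp add: divide_simps)
  qed
qed

text \<open>Integrate the pointwise bound: by invariance the average Birkhoff sum of
  \<open>g\<close> has exactly the integral of \<open>g\<close>, whatever \<open>n\<close>
  is.\<close>

lemma AAP_integral_approx:
  assumes F: "AAP X T F" and M: "M \<in> inv_measures X T" and g: "continuous_on X g"
    and n: "n > 0" and le: "\<And>x. x \<in> X \<Longrightarrow> \<bar>F n x / n - birkhoff_sum T n g x / n\<bar> \<le> \<xi>"
  shows "\<bar>(1 / real n) * integral\<^sup>L M (F n) - integral\<^sup>L M g\<bar> \<le> \<xi>"
proof -
  have "borel_prob X M" using M by (simp add: inv_measures_iff)
  have "\<bar>integral\<^sup>L M (\<lambda>x. F n x / n) - integral\<^sup>L M (\<lambda>x. birkhoff_sum T n g x / n)\<bar> \<le> \<xi>"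
    using F n unfolding AAP_def
    by (intro borel_prob_integral_diff_le[OF compact] le \<open>borel_prob X M\<close> continuous_intros
        continuous_on_birkhoff_sum g) auto
  then show ?thesis using integral_birkhoff_sum[OF M g] n by simp
qed

text \<open>The \<open>lim\<close> in \<open>Fstar\<close> is informative only once convergence is
  known. It holds since all late terms lie within \<open>e / 3\<close> of one number, the integral
  of \<open>g\<close>.\<close>

lemma Fstar_tendsto:
  assumes F: "AAP X T F" and M: "M \<in> inv_measures X T"
  shows "(\<lambda>n. (1 / real n) * integral\<^sup>L M (F n)) \<longlonglongrightarrow> Fstar F M"
proof -
  have "Cauchy (\<lambda>n. (1 / real n) * integral\<^sup>L M (F n))"
  proof (rule metric_CauchyI)
    fix e :: real assume "e > 0"
    then have "e / 3 > 0" by simp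
    then obtain g N where g: "continuous_on X g"
      "\<And>n x. n \<ge> N \<Longrightarrow> x \<in> X \<Longrightarrow> n > 0 \<and> \<bar>F n x / n - birkhoff_sum T n g x / n\<bar> \<le> e / 3"
      using AAP_uniform_approx[OF F] by metis
    let ?I = "\<lambda>n. (1 / real n) * integral\<^sup>L M (F n)"
    have near: "\<bar>?I n - integral\<^sup>L M g\<bar> \<le> e / 3" if "n \<ge> N" for n
      using AAP_integral_approx[OF F M g(1), of n "e/3"] g(2)[OF that] nonempty by blast
    have "dist (?I m) (?I n) < e" if "m \<ge> N" "n \<ge> N" for m n
      using near[OF that(1)] near[OF that(2)] \<open>e > 0\<close> unfolding dist_real_def by linarith
    then show "\<exists>N. \<forall>m\<ge>N. \<forall>n\<ge>N. dist (?I m) (?I n) < e" by blast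
  qed
  then show ?thesis
    unfolding Fstar_def by (simp add: Cauchy_convergent_iff convergent_LIMSEQ_iff)
qed

text \<open>One \<open>g\<close> serves the pointwise averages and all invariant measures at once;
  the bound for measures is \<open>AAP_integral_approx\<close> in the limit.\<close>

lemma AAP_approx:
  assumes F: "AAP X T F" and "\<xi> > 0"
  obtains g N where "continuous_on X g"
    "\<And>n x. n \<ge> N \<Longrightarrow> x \<in> X \<Longrightarrow> \<bar>F n x / n - birkhoff_sum T n g x / n\<bar> \<le> \<xi>"
    "\<And>M. M \<in> inv_measures X T \<Longrightarrow> \<bar>Fstar F M - integral\<^sup>L M g\<bar> \<le> \<xi>"
proof -
  obtain g N where g: "continuous_on X g"
    and N: "\<And>n x. n \<ge> N \<Longrightarrow> x \<in> X \<Longrightarrow> n > 0 \<and> \<bar>F n x / n - birkhoff_sum T n g x / n\<bar> \<le> \<xi>"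
    using AAP_uniform_approx[OF assms] by metis
  have "\<bar>Fstar F M - integral\<^sup>L M g\<bar> \<le> \<xi>" if M: "M \<in> inv_measures X T" for M
  proof (rule Lim_bounded[of _ _ N])
    show "(\<lambda>n. \<bar>(1 / real n) * integral\<^sup>L M (F n) - integral\<^sup>L M g\<bar>) \<longlonglongrightarrow> \<bar>Fstar F M - integral\<^sup>L M g\<bar>"
      by (intro tendsto_intros Fstar_tendsto[OF F M])
    show "\<forall>n\<ge>N. \<bar>(1 / real n) * integral\<^sup>L M (F n) - integral\<^sup>L M g\<bar> \<le> \<xi>"
      using AAP_integral_approx[OF F M g] N nonempty by blast
  qed
  then show thesis using that g N by blast
qed

text \<open>Convergence is given only for fixed continuous functions, so an approximant
  \<open>g\<close> mediates: \<open>e / 3\<close> at the point, \<open>e / 3\<close> at the measure,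
  \<open>e / 3\<close> for the convergence of its averages.\<close>

lemma emp_limits_tendsto_Fstar:
  assumes F: "AAP X T F" and M: "M \<in> inv_measures X T" and x: "x \<in> X" and r: "strict_mono r"
    and conv: "\<And>g. continuous_on X g \<Longrightarrow>
      (\<lambda>k. (1 / real (r k)) * birkhoff_sum T (r k) g x) \<longlonglongrightarrow> integral\<^sup>L M g"
  shows "(\<lambda>k. F (r k) x / r k) \<longlonglongrightarrow> Fstar F M"
proof (rule tendstoI)
  fix e :: real assume "e > 0"
  then have "e / 3 > 0" by simp
  then obtain g N where g: "continuous_on X g"
    and N: "\<And>n x. n \<ge> N \<Longrightarrow> x \<in> X \<Longrightarrow> \<bar>F n x / n - birkhoff_sum T n g x / n\<bar> \<le> e / 3"
    and star: "\<And>M. M \<in> inv_measures X T \<Longrightarrow> \<bar>Fstar F M - integral\<^sup>L M g\<bar> \<le> e / 3"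
    using AAP_approx[OF F] by metis
  have "eventually (\<lambda>k. dist ((1 / real (r k)) * birkhoff_sum T (r k) g x) (integral\<^sup>L M g) < e / 3)
      sequentially"
    by (rule tendstoD[OF conv[OF g] \<open>e / 3 > 0\<close>])
  moreover have "eventually (\<lambda>k. r k \<ge> N) sequentially"
    using r filterlim_subseq[OF r] by (simp add: filterlim_at_top)
  ultimately show "eventually (\<lambda>k. dist (F (r k) x / r k) (Fstar F M) < e) sequentially"
  proof eventually_elim
    case (elim k)
    have "\<bar>birkhoff_sum T (r k) g x / r k - integral\<^sup>L M g\<bar> < e / 3"
      using elim(1) by (simp add: dist_real_def)
    then show ?case using N[OF elim(2) x] star[OF M] unfolding dist_real_def by linarith
  qed
qed

text \<open>The Krylov-Bogolyubov argument: Birkhoff sums of \<open>g\<close> and of its composition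
  with \<open>T\<close> differ by a bounded boundary term, so their averages have the same limit.
  Continuous functions then determine the measure.\<close>

lemma emp_limits_invariant:
  assumes x: "x \<in> X" and M: "M \<in> emp_limits X T x"
  shows "M \<in> inv_measures X T"
proof -
  obtain r :: "nat \<Rightarrow> nat" where P: "borel_prob X M" and r: "strict_mono r"
    and conv: "\<And>g. continuous_on X g \<Longrightarrow>
      (\<lambda>k. (1 / real (r k)) * birkhoff_sum T (r k) g x) \<longlonglongrightarrow> integral\<^sup>L M g"
    using M unfolding emp_limits_def by blast
  have eq: "(\<integral>y. g (T y) \<partial>M) = integral\<^sup>L M g" if g: "continuous_on X g" for g :: "'a \<Rightarrow> real"
  proof -
    obtain B where B: "\<And>y. y \<in> X \<Longrightarrow> \<bar>g y\<bar> \<le> B"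
      using compact_continuous_bound[OF compact g] by metis
    have shift: "birkhoff_sum T n (\<lambda>y. g (T y)) x - birkhoff_sum T n g x = g ((T ^^ n) x) - g x" for n
      unfolding birkhoff_sum_def sum_subtractf[symmetric]
      using sum_lessThan_telescope[of "\<lambda>i. g ((T ^^ i) x)" n] by simp
    have "(\<lambda>n. (1 / real n) * (g ((T ^^ n) x) - g x)) \<longlonglongrightarrow> 0"
    proof (rule Lim_null_comparison)
      have "norm ((1 / real n) * (g ((T ^^ n) x) - g x)) \<le> 2 * B / real n" for n
      proof -
        have "\<bar>g ((T ^^ n) x) - g x\<bar> \<le> 2 * B"
          using B[OF x] B[OF funpow_in[OF x, of n]] by linarith
        then show ?thesis by (simp add: divide_right_mono)
      qed
      then show "eventually (\<lambda>n. norm ((1 / real n) * (g ((T ^^ n) x) - g x)) \<le> 2 * B / real n) sequentially"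
        by simp
      show "(\<lambda>n. 2 * B / real n) \<longlonglongrightarrow> 0" by (rule lim_const_over_n)
    qed
    from LIMSEQ_subseq_LIMSEQ[OF this r]
    have "(\<lambda>k. (1 / real (r k)) * birkhoff_sum T (r k) (\<lambda>y. g (T y)) x
        - (1 / real (r k)) * birkhoff_sum T (r k) g x) \<longlonglongrightarrow> 0"
      by (simp add: o_def right_diff_distrib[symmetric] shift del: times_divide_eq_left)
    moreover have "(\<lambda>k. (1 / real (r k)) * birkhoff_sum T (r k) (\<lambda>y. g (T y)) x
        - (1 / real (r k)) * birkhoff_sum T (r k) g x) \<longlonglongrightarrow> (\<integral>y. g (T y) \<partial>M) - integral\<^sup>L M g"
      using continuous_on_compose_funpow[OF g, of 1] by (intro tendsto_diff conv g) simp
    ultimately have "0 = (\<integral>y. g (T y) \<partial>M) - integral\<^sup>L M g" by (rule LIMSEQ_unique)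
    then show ?thesis by simp
  qed
  have distr: "borel_prob X (distr M M T)"
    using prob_space.prob_space_distr[OF borel_prob_prob_space[OF P] measurable_map[OF P]]
      borel_prob_sets[OF P] by (simp add: borel_prob_def)
  have "distr M M T = M"
    by (rule borel_prob_eqI[OF compact distr P]) (simp add: integral_compose_map[OF P] eq)
  then show ?thesis using P by (simp add: inv_measures_iff)
qed

section \<open>Compactness of empirical measures\<close>

text \<open>Empirical measures are finitely supported, so they lift along an arbitrary (not necessarily
  measurable) section of a continuous surjection from a compact set of reals onto \<open>X\<close>. Helly's
  selection theorem applies upstairs and the limit is pushed forward.\<close>

lemma empirical_limit_exists:
  fixes r0 :: "nat \<Rightarrow> nat"
  assumes x: "x \<in> X" and r0: "strict_mono r0"
  obtains r :: "nat \<Rightarrow> nat" and M where "strict_mono r" "borel_prob X M"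
    "\<And>g. continuous_on X g \<Longrightarrow>
      (\<lambda>k. (1 / real (r0 (r k))) * birkhoff_sum T (r0 (r k)) g x) \<longlonglongrightarrow> integral\<^sup>L M g"
proof -
  obtain K :: "real set" and p and s :: "'a \<Rightarrow> real"
    where K: "compact K" and p: "continuous_on K p" "p ` K \<subseteq> X"
      and s: "\<And>y. y \<in> X \<Longrightarrow> s y \<in> K" and ps: "\<And>y. y \<in> X \<Longrightarrow> p (s y) = y"
    using compact_metric_continuous_image_of_compact_real[OF compact nonempty] by metis
  have "closed K" using K by (rule compact_imp_closed)
  have "K \<noteq> {}" using s[OF x] by auto
  \<comment> \<open>The empirical measure of the codes of the first \<open>n\<close> orbit points.
    All sets of indices are measurable, so \<open>s\<close> may be arbitrary. For
    \<open>n = 0\<close> the \<open>pmf\<close> is unspecified but still a probability, so tightness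
    needs no exception.\<close>
  define \<nu> where
    "\<nu> n = distr (measure_pmf (pmf_of_set {..<n})) borel (\<lambda>i. s ((T ^^ i) x))" for n
  have real_distr: "real_distribution (\<nu> n)" for n
    unfolding \<nu>_def by (intro prob_space.real_distribution_distr[OF prob_space_measure_pmf]) simp
  have orbit: "s ((T ^^ i) x) \<in> K" for i using s funpow_in[OF x] by blast
  have integral_\<nu>: "integral\<^sup>L (\<nu> n) f = (\<integral>i. f (s ((T ^^ i) x)) \<partial>measure_pmf (pmf_of_set {..<n}))"
    if "f \<in> borel_measurable borel" for f :: "real \<Rightarrow> real" and n
    unfolding \<nu>_def using that by (intro integral_distr) auto
  have tight: "tight \<nu>"
    unfolding tight_def
  proof (intro conjI allI impI real_distr)
    fix e :: real assume "e > 0"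
    obtain B where B: "B > 0" "\<And>t. t \<in> K \<Longrightarrow> \<bar>t\<bar> \<le> B"
      using compact_imp_bounded[OF K] bounded_pos[of K] by auto
    have "s ((T ^^ i) x) \<in> {- B - 1<..B}" for i
      using B(2)[OF orbit[of i]] by auto
    then have "(\<lambda>i. s ((T ^^ i) x)) -` {- B - 1<..B} = UNIV" by blast
    then have "measure (\<nu> n) {- B - 1<..B} = 1" for n
      unfolding \<nu>_def by (simp add: measure_distr)
    then show "\<exists>a b. a < b \<and> (\<forall>n. 1 - e < measure (\<nu> n) {a<..b})"
      using \<open>e > 0\<close> \<open>B > 0\<close> by (intro exI[of _ "- B - 1"] exI[of _ B]) simp
  qed
  obtain r :: "nat \<Rightarrow> nat" and N where r: "strict_mono r" and N: "real_distribution N"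
    and weak: "weak_conv_m (\<nu> \<circ> r0 \<circ> r) N"
    using tight_imp_convergent_subsubsequence[OF tight r0] by blast
  interpret N: real_distribution N by fact
  have conv: "(\<lambda>k. integral\<^sup>L (\<nu> (r0 (r k))) f) \<longlonglongrightarrow> integral\<^sup>L N f"
    if "continuous_on UNIV f" "\<And>t. \<bar>f t\<bar> \<le> B" for f :: "real \<Rightarrow> real" and B
    using weak_conv_imp_integral_bdd_continuous_conv[of "\<nu> \<circ> r0 \<circ> r" N f B, OF _ N weak] that real_distr
    by (simp add: continuous_on_eq_continuous_at)
  have AE_K: "AE t in N. t \<in> K"
  proof -
    \<comment> \<open>A bounded continuous function vanishing exactly on \<open>K\<close>: its
      integrals are 0 along the sequence, hence 0 for the limit.\<close>
    let ?h = "\<lambda>t. min 1 (infdist t K)"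
    have h_cont: "continuous_on UNIV ?h" by (intro continuous_intros)
    have h_meas: "?h \<in> borel_measurable borel"
      by (rule borel_measurable_continuous_onI[OF h_cont])
    have h_bound: "\<bar>?h t\<bar> \<le> 1" for t using infdist_nonneg[of t K] by auto
    have "integral\<^sup>L (\<nu> n) ?h = 0" for n
      using orbit by (simp add: integral_\<nu>[OF h_meas])
    then have "integral\<^sup>L N ?h = 0"
      using conv[OF h_cont h_bound] LIMSEQ_const_iff[of "0::real"] by simp
    moreover have "integrable N ?h"
      by (rule N.integrable_const_bound[of _ 1])
         (use h_bound h_meas in \<open>auto simp: measurable_cong_sets[OF N.events_eq_borel refl]\<close>)
    ultimately have "AE t in N. ?h t = 0"
      by (subst integral_nonneg_eq_0_iff_AE[symmetric]) (auto simp: infdist_nonneg)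
    then show ?thesis
    proof eventually_elim
      case (elim t)
      then have "infdist t K = 0" by (auto simp: min_def split: if_splits)
      then show ?case using in_closed_iff_infdist_zero[OF \<open>closed K\<close> \<open>K \<noteq> {}\<close>] by simp
    qed
  qed
  \<comment> \<open>Off \<open>K\<close> any value in \<open>X\<close> will do, since
    \<open>N\<close> lives on \<open>K\<close>; closedness of \<open>K\<close> keeps
    \<open>q\<close> Borel.\<close>
  define q where "q t = (if t \<in> K then p t else x)" for t
  have q_X: "q t \<in> X" for t using p(2) x by (auto simp: q_def)
  have "q \<in> borel_measurable borel"
    unfolding q_def
    by (subst measurable_If_restrict_space_iff)
       (use \<open>closed K\<close> borel_measurable_continuous_on_restrict[OF p(1)] in auto)
  then have q_meas: "q \<in> measurable N (restrict_space borel X)"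
    using q_X by (intro measurable_restrict_space2) (auto simp: measurable_cong_sets[OF N.events_eq_borel refl])
  define M where "M = distr N (restrict_space borel X) q"
  have M: "borel_prob X M"
    unfolding borel_prob_def M_def using N.prob_space_distr[OF q_meas] by simp
  show thesis
  proof (rule that[OF r M])
    fix g :: "'a \<Rightarrow> real" assume g: "continuous_on X g"
    obtain B where B: "B \<ge> 0" "\<And>y. y \<in> X \<Longrightarrow> \<bar>g y\<bar> \<le> B"
      using compact_continuous_bound[OF compact g] by metis
    have "continuous_on K (\<lambda>t. g (p t))"
      by (rule continuous_on_compose2[OF g p])
    moreover have "norm (g (p t)) \<le> B" if "t \<in> K" for t
      using B(2)[of "p t"] p(2) that by auto
    \<comment> \<open>Weak convergence on the line asks for test functions continuous and bounded
      everywhere. The composition of \<open>g\<close> with \<open>p\<close> is controlled on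
      \<open>K\<close> only, and Tietze extends it with the same bound.\<close>
    ultimately obtain h where h: "continuous_on UNIV h" "\<And>t. t \<in> K \<Longrightarrow> h t = g (p t)"
      and h_bound: "\<And>t. norm (h t) \<le> B"
      using Tietze[of K "\<lambda>t. g (p t)" UNIV B] \<open>closed K\<close> \<open>B \<ge> 0\<close> by auto
    have h_meas: "h \<in> borel_measurable borel" by (rule borel_measurable_continuous_onI[OF h(1)])
    have g_meas: "g \<in> borel_measurable (restrict_space borel X)"
      by (rule borel_measurable_continuous_on_restrict[OF g])
    have "integral\<^sup>L M g = (\<integral>t. g (q t) \<partial>N)"
      unfolding M_def by (rule integral_distr[OF q_meas g_meas])
    also have "\<dots> = integral\<^sup>L N h"
    proof (rule integral_cong_AE)
      show "(\<lambda>t. g (q t)) \<in> borel_measurable N" by (rule measurable_compose[OF q_meas g_meas])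
      show "h \<in> borel_measurable N"
        using h_meas by (simp add: measurable_cong_sets[OF N.events_eq_borel refl])
      show "AE t in N. g (q t) = h t" using AE_K by eventually_elim (simp add: q_def h(2))
    qed
    finally have limit: "integral\<^sup>L M g = integral\<^sup>L N h" .
    \<comment> \<open>Orbit points are recovered from their codes by \<open>p\<close>.\<close>
    have "integral\<^sup>L (\<nu> n) h = (1 / real n) * birkhoff_sum T n g x" if "n > 0" for n
    proof -
      have "integral\<^sup>L (\<nu> n) h = (\<integral>i. g ((T ^^ i) x) \<partial>measure_pmf (pmf_of_set {..<n}))"
        using orbit ps[OF funpow_in[OF x]] by (simp add: integral_\<nu>[OF h_meas] h(2))
      also have "\<dots> = (1 / real n) * birkhoff_sum T n g x"
        using that unfolding birkhoff_sum_def by (subst integral_pmf_of_set) auto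
      finally show ?thesis .
    qed
    moreover have "eventually (\<lambda>k. r0 (r k) > 0) sequentially"
    proof -
      have "eventually (\<lambda>k. 1 \<le> (r0 \<circ> r) k) sequentially"
        using filterlim_subseq[OF strict_mono_o[OF r0 r]] unfolding filterlim_at_top by blast
      then show ?thesis by eventually_elim simp
    qed
    ultimately have ev: "eventually (\<lambda>k. integral\<^sup>L (\<nu> (r0 (r k))) h
        = (1 / real (r0 (r k))) * birkhoff_sum T (r0 (r k)) g x) sequentially"
      by (auto elim: eventually_mono)
    have "(\<lambda>k. integral\<^sup>L (\<nu> (r0 (r k))) h) \<longlonglongrightarrow> integral\<^sup>L M g"
      unfolding limit using conv[OF h(1), of B] h_bound by simp
    then show "(\<lambda>k. (1 / real (r0 (r k))) * birkhoff_sum T (r0 (r k)) g x) \<longlonglongrightarrow> integral\<^sup>L M g"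
      using tendsto_cong[OF ev] by simp
  qed
qed

text \<open>Pass to a subsequence realising the upper limit, then to a further one along which the
  empirical measures converge; \<open>emp_limits_tendsto_Fstar\<close> identifies the limit.\<close>

lemma limsup_attained_on_emp_limits:
  assumes F: "AAP X T F" and x: "x \<in> X"
  obtains M where "M \<in> emp_limits X T x" "ereal (Fstar F M) = limsup (\<lambda>n. ereal (F n x / n))"
proof -
  obtain r0 :: "nat \<Rightarrow> nat" where r0: "strict_mono r0"
    and lim: "((\<lambda>n. ereal (F n x / n)) \<circ> r0) \<longlonglongrightarrow> limsup (\<lambda>n. ereal (F n x / n))"
    using limsup_subseq_lim by blast
  obtain r :: "nat \<Rightarrow> nat" and M where r: "strict_mono r" and M: "borel_prob X M"
    and conv: "\<And>g. continuous_on X g \<Longrightarrow>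
      (\<lambda>k. (1 / real (r0 (r k))) * birkhoff_sum T (r0 (r k)) g x) \<longlonglongrightarrow> integral\<^sup>L M g"
    by (rule empirical_limit_exists[OF x r0]) (rule that)
  have mono: "strict_mono (r0 \<circ> r)" by (rule strict_mono_o[OF r0 r])
  have in_V: "M \<in> emp_limits X T x"
    unfolding emp_limits_def using M conv mono by (auto intro!: exI[of _ "r0 \<circ> r"])
  have "(\<lambda>k. F ((r0 \<circ> r) k) x / (r0 \<circ> r) k) \<longlonglongrightarrow> Fstar F M"
    by (rule emp_limits_tendsto_Fstar[OF F emp_limits_invariant[OF x in_V] x mono]) (use conv in simp)
  then have "(\<lambda>k. ereal (F (r0 (r k)) x / r0 (r k))) \<longlonglongrightarrow> ereal (Fstar F M)" by simp
  moreover have "(\<lambda>k. ereal (F (r0 (r k)) x / r0 (r k))) \<longlonglongrightarrow> limsup (\<lambda>n. ereal (F n x / n))"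
    using LIMSEQ_subseq_LIMSEQ[OF lim r] by (simp add: o_def)
  ultimately have "ereal (Fstar F M) = limsup (\<lambda>n. ereal (F n x / n))" by (rule LIMSEQ_unique)
  with in_V that show thesis by blast
qed

section \<open>Specification and irregular points\<close>

text \<open>Trace longer and longer finite families of blocks and take a limit point. Each
  inequality involves fixed iterates, so it survives by continuity, with \<open><\<close> weakened
  to \<open>\<le>\<close>.\<close>

lemma infinite_specification:
  assumes spec: "spec_property X T" and "e > 0"
  obtains m :: nat where "\<And>(a :: nat \<Rightarrow> nat) b xs. \<lbrakk>\<And>j. a j \<le> b j; \<And>j. b j + m \<le> a (Suc j); \<And>j. xs j \<in> X\<rbrakk> \<Longrightarrow>
    \<exists>x\<in>X. \<forall>j. \<forall>p\<le>b j - a j. dist ((T ^^ (p + a j)) x) ((T ^^ p) (xs j)) \<le> e"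
proof -
  obtain m :: nat where m: "\<forall>(k::nat) (a::nat \<Rightarrow> nat) (b::nat \<Rightarrow> nat) xs.
      k \<ge> 1 \<and> (\<forall>j<k. a j \<le> b j) \<and>
      (\<forall>j. Suc j < k \<longrightarrow> int (a (Suc j)) - int (b j) \<ge> int m) \<and>
      (\<forall>j<k. xs j \<in> X) \<longrightarrow>
      (\<exists>x\<in>X. \<forall>j<k. \<forall>p\<le>b j - a j. dist ((T ^^ (p + a j)) x) ((T ^^ p) (xs j)) < e)"
    using spec \<open>e > 0\<close> unfolding spec_property_def by blast
  show thesis
  proof (rule that)
    fix a b :: "nat \<Rightarrow> nat" and xs :: "nat \<Rightarrow> 'a"
    assume ab: "\<And>j. a j \<le> b j" and gap: "\<And>j. b j + m \<le> a (Suc j)" and xs: "\<And>j. xs j \<in> X"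
    have gap': "int (a (Suc j)) - int (b j) \<ge> int m" for j using gap[of j] by linarith
    have "\<exists>x\<in>X. \<forall>j<Suc k. \<forall>p\<le>b j - a j. dist ((T ^^ (p + a j)) x) ((T ^^ p) (xs j)) < e" for k
      using m[rule_format, of "Suc k" a b xs] ab gap' xs by simp
    then obtain y where y: "\<And>k. y k \<in> X"
      and tracing: "\<And>k j p. j < Suc k \<Longrightarrow> p \<le> b j - a j \<Longrightarrow> dist ((T ^^ (p + a j)) (y k)) ((T ^^ p) (xs j)) < e"
      by metis
    obtain x r where x: "x \<in> X" and r: "strict_mono (r :: nat \<Rightarrow> nat)" and lim: "(y \<circ> r) \<longlonglongrightarrow> x"
      using compact_imp_seq_compact[OF compact] y unfolding seq_compact_def by blast
    have "dist ((T ^^ (p + a j)) x) ((T ^^ p) (xs j)) \<le> e" if p: "p \<le> b j - a j" for j p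
    proof (rule Lim_bounded)
      have "(\<lambda>k. (T ^^ (p + a j)) ((y \<circ> r) k)) \<longlonglongrightarrow> (T ^^ (p + a j)) x"
        by (rule continuous_on_tendsto_compose[OF continuous_on_funpow lim x]) (simp add: y)
      then show "(\<lambda>k. dist ((T ^^ (p + a j)) ((y \<circ> r) k)) ((T ^^ p) (xs j)))
          \<longlonglongrightarrow> dist ((T ^^ (p + a j)) x) ((T ^^ p) (xs j))"
        by (intro tendsto_intros)
      show "\<forall>k\<ge>j. dist ((T ^^ (p + a j)) ((y \<circ> r) k)) ((T ^^ p) (xs j)) \<le> e"
      proof (intro allI impI)
        fix k assume "j \<le> k"
        then have "j < Suc (r k)" using seq_suble[OF r, of k] by simp
        from tracing[OF this p] show "dist ((T ^^ (p + a j)) ((y \<circ> r) k)) ((T ^^ p) (xs j)) \<le> e"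
          by simp
      qed
    qed
    with x show "\<exists>x\<in>X. \<forall>j. \<forall>p\<le>b j - a j. dist ((T ^^ (p + a j)) x) ((T ^^ p) (xs j)) \<le> e"
      by blast
  qed
qed

text \<open>For a given system, start times and lengths depend on \<open>e\<close> only, so the
  traced points may later be chosen in terms of the lengths. What precedes block \<open>k\<close> is
  at most a fraction \<open>1 / Suc k\<close> of its length.\<close>

lemma specification_dominating_blocks:
  assumes spec: "spec_property X T" and "e > 0"
  obtains a n :: "nat \<Rightarrow> nat" where "\<And>k. Suc k * a k \<le> n k" "\<And>k. k < n k"
    "\<And>xs :: nat \<Rightarrow> 'a. (\<And>k. xs k \<in> X) \<Longrightarrow>
      \<exists>x\<in>X. \<forall>k. \<forall>p<n k. dist ((T ^^ (p + a k)) x) ((T ^^ p) (xs k)) \<le> e"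
proof -
  obtain m :: nat where m: "\<And>(a :: nat \<Rightarrow> nat) b xs. \<lbrakk>\<And>j. a j \<le> b j; \<And>j. b j + m \<le> a (Suc j); \<And>j. xs j \<in> X\<rbrakk> \<Longrightarrow>
    \<exists>x\<in>X. \<forall>j. \<forall>p\<le>b j - a j. dist ((T ^^ (p + a j)) x) ((T ^^ p) (xs j)) \<le> e"
    using infinite_specification[OF assms] by blast
  \<comment> \<open>The next block starts after block \<open>k\<close> and a gap \<open>m\<close>.
    The factor \<open>Suc ak\<close> instead of \<open>ak\<close> keeps lengths positive although
    \<open>a 0 = 0\<close>.\<close>
  define a where "a = rec_nat 0 (\<lambda>k ak. ak + Suc k * Suc ak + m)"
  define n where "n k = Suc k * Suc (a k)" for k
  have a_Suc: "a (Suc k) = a k + n k + m" for k by (simp add: a_def n_def)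
  show thesis
  proof (rule that)
    show "Suc k * a k \<le> n k" "k < n k" for k by (simp_all add: n_def)
    fix xs :: "nat \<Rightarrow> 'a" assume "\<And>k. xs k \<in> X"
    then obtain x where "x \<in> X"
      "\<And>k p. p \<le> n k \<Longrightarrow> dist ((T ^^ (p + a k)) x) ((T ^^ p) (xs k)) \<le> e"
      using m[of a "\<lambda>k. a k + n k" xs] a_Suc by auto
    then show "\<exists>x\<in>X. \<forall>k. \<forall>p<n k. dist ((T ^^ (p + a k)) x) ((T ^^ p) (xs k)) \<le> e"
      by (intro bexI[of _ x]) auto
  qed
qed

section \<open>Averages along traced orbit segments\<close>

lemma birkhoff_sum_add:
  "birkhoff_sum T (a + n) g x = birkhoff_sum T a g x + (\<Sum>p<n. g ((T ^^ (p + a)) x))"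
  unfolding birkhoff_sum_def
  by (induction n) (simp_all add: add.commute)

text \<open>Besides the tracing error \<open>\<delta>\<close>, the untraced first \<open>a\<close>
  steps and the change of denominator from \<open>n\<close> to \<open>a + n\<close> cost at most
  \<open>B * (a / n)\<close> each.\<close>

lemma birkhoff_average_tracing:
  assumes x: "x \<in> X" and y: "y \<in> X" and "n > 0"
    and B: "\<And>z. z \<in> X \<Longrightarrow> \<bar>g z\<bar> \<le> B"
    and close: "\<And>p. p < n \<Longrightarrow> \<bar>g ((T ^^ (p + a)) x) - g ((T ^^ p) y)\<bar> \<le> \<delta>"
  shows "\<bar>birkhoff_sum T (a + n) g x / real (a + n) - birkhoff_sum T n g y / n\<bar> \<le> \<delta> + 2 * B * (a / n)"
proof -
  have "B \<ge> 0" using B[OF x] by linarith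
  have "\<delta> \<ge> 0" using close[OF \<open>n > 0\<close>] by linarith
  have sum_bound: "\<bar>birkhoff_sum T i g z\<bar> \<le> real i * B" if "z \<in> X" for i z
    unfolding birkhoff_sum_def
    using sum_norm_bound[of "{..<i}" "\<lambda>j. g ((T ^^ j) z)" B] B funpow_in[OF that] by simp
  define D where "D = (\<Sum>p<n. g ((T ^^ (p + a)) x)) - birkhoff_sum T n g y"
  have D: "\<bar>D\<bar> \<le> real n * \<delta>"
    unfolding D_def birkhoff_sum_def sum_subtractf[symmetric]
    using sum_norm_bound[of "{..<n}" "\<lambda>p. g ((T ^^ (p + a)) x) - g ((T ^^ p) y)" \<delta>] close by simp
  have "real n > 0" using \<open>n > 0\<close> by simp
  \<comment> \<open>From \<open>1 / n = 1 / (a + n) + a / (n * (a + n))\<close>; the last term is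
    the cost of the change of denominator.\<close>
  have "birkhoff_sum T n g y / n
      = birkhoff_sum T n g y / (a + n) + birkhoff_sum T n g y * a / (n * (a + n))"
  proof -
    have "real a + real n \<noteq> 0" using \<open>real n > 0\<close> by linarith
    then show ?thesis using \<open>real n > 0\<close> by (simp add: divide_simps) (simp add: algebra_simps)
  qed
  then have "birkhoff_sum T (a + n) g x / (a + n) - birkhoff_sum T n g y / n
      = birkhoff_sum T a g x / (a + n) + D / (a + n) - birkhoff_sum T n g y * a / (n * (a + n))"
    unfolding D_def birkhoff_sum_add by (simp add: add_divide_distrib diff_divide_distrib)
  moreover have "\<bar>birkhoff_sum T a g x / (a + n)\<bar> \<le> B * (a / n)"
  proof -
    have "\<bar>birkhoff_sum T a g x / (a + n)\<bar> \<le> (real a * B) / (a + n)"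
      using sum_bound[OF x, of a] by (simp add: divide_right_mono)
    also have "\<dots> \<le> (real a * B) / n"
      using \<open>real n > 0\<close> \<open>B \<ge> 0\<close> by (intro divide_left_mono) auto
    finally show ?thesis by (simp add: mult.commute)
  qed
  moreover have "\<bar>D / (a + n)\<bar> \<le> \<delta>"
  proof -
    have "\<bar>D / (a + n)\<bar> \<le> real n * \<delta> / (a + n)" using D by (simp add: divide_right_mono)
    also have "\<dots> \<le> real n * \<delta> / n"
      using \<open>real n > 0\<close> \<open>\<delta> \<ge> 0\<close> by (intro divide_left_mono) auto
    finally show ?thesis using \<open>real n > 0\<close> by simp
  qed
  moreover have "\<bar>birkhoff_sum T n g y * a / (n * (a + n))\<bar> \<le> B * (a / n)"
  proof -
    have "\<bar>birkhoff_sum T n g y * a / (n * (a + n))\<bar> = \<bar>birkhoff_sum T n g y\<bar> * (a / (n * (a + n)))"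
      by (simp add: abs_mult)
    also have "\<dots> \<le> (real n * B) * (a / (n * (a + n)))"
      using sum_bound[OF y, of n] by (intro mult_right_mono) auto
    also have "\<dots> = real a * B / (a + n)" using \<open>real n > 0\<close> by simp
    also have "\<dots> \<le> (real a * B) / n"
      using \<open>real n > 0\<close> \<open>B \<ge> 0\<close> by (intro divide_left_mono) auto
    finally show ?thesis by (simp add: mult.commute)
  qed
  moreover have "2 * B * (real a / real n) = B * (a / n) + B * (a / n)" by simp
  ultimately show ?thesis unfolding of_nat_add by linarith
qed

text \<open>The precision \<open>e\<close> is fixed before the blocks are known and need not shrink
  along them. Two quarters of \<open>\<xi>\<close> pay for replacing \<open>F\<close> by Birkhoff
  sums of \<open>g\<close>, one for uniform continuity, one for the steps before the block.\<close>

lemma AAP_tracing: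
  assumes F: "AAP X T F" and "\<xi> > 0"
  obtains e where "e > 0"
    "\<And>(a :: nat \<Rightarrow> nat) n x xs. \<lbrakk>\<And>k. Suc k * a k \<le> n k; \<And>k. k < n k; x \<in> X; \<And>k. xs k \<in> X;
       \<And>k p. p < n k \<Longrightarrow> dist ((T ^^ (p + a k)) x) ((T ^^ p) (xs k)) \<le> e\<rbrakk> \<Longrightarrow>
       eventually (\<lambda>k. \<bar>F (a k + n k) x / (a k + n k) - F (n k) (xs k) / n k\<bar> \<le> \<xi>) sequentially"
proof -
  have "\<xi> / 4 > 0" using \<open>\<xi> > 0\<close> by simp
  then obtain g N where g: "continuous_on X g"
    and N: "\<And>n x. n \<ge> N \<Longrightarrow> x \<in> X \<Longrightarrow> \<bar>F n x / n - birkhoff_sum T n g x / n\<bar> \<le> \<xi> / 4"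
    using AAP_approx[OF F] by metis
  obtain B where "B \<ge> 0" and B: "\<And>z. z \<in> X \<Longrightarrow> \<bar>g z\<bar> \<le> B"
    using compact_continuous_bound[OF compact g] by metis
  have "uniformly_continuous_on X g"
    by (rule compact_uniformly_continuous[OF g compact])
  then obtain d where "d > 0"
    and d: "\<And>y z. y \<in> X \<Longrightarrow> z \<in> X \<Longrightarrow> dist y z < d \<Longrightarrow> \<bar>g y - g z\<bar> < \<xi> / 4"
    unfolding uniformly_continuous_on_def dist_real_def using \<open>\<xi> / 4 > 0\<close> by metis
  show thesis
  proof (rule that)
    \<comment> \<open>Half of \<open>d\<close>, because tracing gives a weak inequality and uniform
      continuity asks for a strict one.\<close>
    show "d / 2 > 0" using \<open>d > 0\<close> by simp
    fix a n :: "nat \<Rightarrow> nat" and x and xs :: "nat \<Rightarrow> 'a"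
    assume a: "\<And>k. Suc k * a k \<le> n k" and n: "\<And>k. k < n k" and x: "x \<in> X" and xs: "\<And>k. xs k \<in> X"
      and tracing: "\<And>k p. p < n k \<Longrightarrow> dist ((T ^^ (p + a k)) x) ((T ^^ p) (xs k)) \<le> d / 2"
    \<comment> \<open>From \<open>K\<close> on, the prefix error, at most
      \<open>2 * B / Suc k\<close>, is at most \<open>\<xi> / 4\<close>.\<close>
    obtain K where K: "8 * B / \<xi> < real K" using reals_Archimedean2 by blast
    show "eventually (\<lambda>k. \<bar>F (a k + n k) x / (a k + n k) - F (n k) (xs k) / n k\<bar> \<le> \<xi>) sequentially"
    proof (rule eventually_sequentiallyI[of "max N K"])
      fix k assume k: "max N K \<le> k"
      have "n k > 0" using n[of k] by simp
      have close: "\<bar>g ((T ^^ (p + a k)) x) - g ((T ^^ p) (xs k))\<bar> \<le> \<xi> / 4" if "p < n k" for p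
        using d[of "(T ^^ (p + a k)) x" "(T ^^ p) (xs k)"] funpow_in x xs tracing[OF that] \<open>d > 0\<close>
        by fastforce
      have "\<bar>birkhoff_sum T (a k + n k) g x / (a k + n k) - birkhoff_sum T (n k) g (xs k) / n k\<bar>
          \<le> \<xi> / 4 + 2 * B * (a k / n k)"
        by (rule birkhoff_average_tracing[OF x xs \<open>n k > 0\<close> B close])
      moreover have "2 * B * (a k / n k) \<le> \<xi> / 4"
      proof -
        have "real (Suc k) * real (a k) \<le> real (n k)"
          using a[of k] by (simp only: of_nat_mult[symmetric] of_nat_le_iff)
        then have "a k / n k \<le> 1 / Suc k" using \<open>n k > 0\<close> by (simp add: divide_simps mult.commute)
        then have "2 * B * (a k / n k) \<le> 2 * B * (1 / Suc k)"
          using \<open>B \<ge> 0\<close> by (intro mult_left_mono) auto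
        moreover have "8 * B \<le> \<xi> * Suc k"
        proof -
          have "8 * B \<le> \<xi> * K" using K \<open>\<xi> > 0\<close> by (simp add: divide_simps mult.commute)
          also have "\<dots> \<le> \<xi> * Suc k" using k \<open>\<xi> > 0\<close> by (intro mult_left_mono) auto
          finally show ?thesis .
        qed
        then have "2 * B * (1 / Suc k) \<le> \<xi> / 4" by (simp add: divide_simps mult.commute)
        ultimately show ?thesis by linarith
      qed
      moreover have "\<bar>F (n k) (xs k) / n k - birkhoff_sum T (n k) g (xs k) / n k\<bar> \<le> \<xi> / 4"
        by (rule N[OF _ xs]) (use n[of k] k in auto)
      moreover have "\<bar>F (a k + n k) x / (a k + n k) - birkhoff_sum T (a k + n k) g x / (a k + n k)\<bar> \<le> \<xi> / 4"
        using N[OF _ x, of "a k + n k"] n[of k] k by auto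
      ultimately show "\<bar>F (a k + n k) x / (a k + n k) - F (n k) (xs k) / n k\<bar> \<le> \<xi>"
        by linarith
    qed
  qed
qed

section \<open>Orbit segments with extreme averages and the oscillating orbit\<close>

lemma AAP_points_above:
  assumes F: "AAP X T F" and M: "M \<in> inv_measures X T" and c: "c < Fstar F M"
  obtains w where "\<And>n. w n \<in> X" "eventually (\<lambda>n. c < F n (w n) / n) sequentially"
proof -
  \<comment> \<open>The implication under the quantifier allows a choice for every \<open>n\<close>,
    also where the integral is not yet above \<open>c\<close>.\<close>
  have "\<exists>y\<in>X. n > 0 \<and> c < (1 / real n) * integral\<^sup>L M (F n) \<longrightarrow> c < F n y / n" for n
  proof (cases "n > 0 \<and> c < (1 / real n) * integral\<^sup>L M (F n)")
    case True
    have "continuous_on X (\<lambda>y. F n y / n)"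
      using F True unfolding AAP_def by (intro continuous_intros) auto
    moreover have "c < integral\<^sup>L M (\<lambda>y. F n y / n)" using True by simp
    ultimately show ?thesis
      using borel_prob_integral_less_point[OF compact, of M] M by (metis inv_measures_iff)
  qed (use nonempty in blast)
  then obtain w where w: "\<And>n. w n \<in> X"
    "\<And>n. n > 0 \<and> c < (1 / real n) * integral\<^sup>L M (F n) \<Longrightarrow> c < F n (w n) / n"
    by metis
  show thesis
  proof (rule that[OF w(1)])
    show "eventually (\<lambda>n. c < F n (w n) / n) sequentially"
      using order_tendstoD(1)[OF Fstar_tendsto[OF F M] c] eventually_gt_at_top[of 0]
      by eventually_elim (simp add: w(2))
  qed
qed

text \<open>Lets \<open>AAP_points_above\<close> also produce points with small averages.\<close>

lemma AAP_uminus: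
  assumes "AAP X T F"
  shows "AAP X T (\<lambda>n x. - F n x)"
  unfolding AAP_def
proof (intro conjI allI impI)
  show "continuous_on X (\<lambda>x. - F n x)" if "n \<ge> 1" for n
    using assms that unfolding AAP_def by (intro continuous_intros) auto
next
  fix \<xi> :: real assume "\<xi> > 0"
  then obtain g where g: "continuous_on X g"
    "limsup (\<lambda>n. ereal ((1 / real n) * (SUP x\<in>X. \<bar>F n x - birkhoff_sum T n g x\<bar>))) < ereal \<xi>"
    using assms unfolding AAP_def by blast
  have "\<bar>- F n x - birkhoff_sum T n (\<lambda>y. - g y) x\<bar> = \<bar>F n x - birkhoff_sum T n g x\<bar>" for n x
    unfolding birkhoff_sum_def sum_negf by (simp add: abs_minus_commute)
  then show "\<exists>g. continuous_on X g \<and>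
      limsup (\<lambda>n. ereal ((1 / real n) * (SUP x\<in>X. \<bar>- F n x - birkhoff_sum T n g x\<bar>))) < ereal \<xi>"
    using g by (intro exI[of _ "\<lambda>y. - g y"]) (simp add: continuous_on_minus)
qed

lemma Fstar_uminus:
  assumes "AAP X T F" "M \<in> inv_measures X T"
  shows "Fstar (\<lambda>n x. - F n x) M = - Fstar F M"
proof (rule LIMSEQ_unique[OF Fstar_tendsto[OF AAP_uminus[OF assms(1)] assms(2)]])
  show "(\<lambda>n. (1 / real n) * integral\<^sup>L M (\<lambda>x. - F n x)) \<longlonglongrightarrow> - Fstar F M"
    using tendsto_minus[OF Fstar_tendsto[OF assms]] by simp
qed

lemma irregular_point_with_large_limsup:
  assumes spec: "spec_property X T" and F: "AAP X T F" and Phi: "AAP X T Phi"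
    and M: "M \<in> inv_measures X T" "c < Fstar F M"
    and M1: "M1 \<in> inv_measures X T" and M2: "M2 \<in> inv_measures X T"
    and gap: "Fstar Phi M1 < Fstar Phi M2"
  obtains x where "x \<in> irregular_set X Phi" "ereal c \<le> limsup (\<lambda>n. ereal (F n x / n))"
proof -
  \<comment> \<open>Each side loses \<open>\<delta>\<close> in the choice of points and
    \<open>\<delta>\<close> in tracing, so a fifth of the gap leaves \<open>\<delta>\<close> between
    them.\<close>
  define \<delta> where "\<delta> = (Fstar Phi M2 - Fstar Phi M1) / 5"
  have "\<delta> > 0" using gap by (simp add: \<delta>_def)
  \<comment> \<open>Half of the excess over \<open>c\<close> is reserved for tracing; the other half
    keeps \<open>c + \<xi>\<close> strictly below \<open>Fstar F M\<close>.\<close>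
  define \<xi> where "\<xi> = (Fstar F M - c) / 2"
  have "\<xi> > 0" using M(2) by (simp add: \<xi>_def)
  have "c + \<xi> < Fstar F M" using M(2) by (simp add: \<xi>_def field_simps)
  then obtain w where w: "\<And>n. w n \<in> X" "eventually (\<lambda>n. c + \<xi> < F n (w n) / n) sequentially"
    using AAP_points_above[OF F M(1)] by metis
  have "Fstar Phi M2 - \<delta> < Fstar Phi M2" using \<open>\<delta> > 0\<close> by simp
  then obtain u where u: "\<And>n. u n \<in> X"
    "eventually (\<lambda>n. Fstar Phi M2 - \<delta> < Phi n (u n) / n) sequentially"
    using AAP_points_above[OF Phi M2] by metis
  have "- Fstar Phi M1 - \<delta> < Fstar (\<lambda>n x. - Phi n x) M1"
    using \<open>\<delta> > 0\<close> Fstar_uminus[OF Phi M1] by simp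
  then obtain v where v: "\<And>n. v n \<in> X"
    "eventually (\<lambda>n. - Fstar Phi M1 - \<delta> < - Phi n (v n) / n) sequentially"
    using AAP_points_above[OF AAP_uminus[OF Phi] M1] by metis
  obtain e1 where e1: "e1 > 0"
    "\<And>(a :: nat \<Rightarrow> nat) n x xs. \<lbrakk>\<And>k. Suc k * a k \<le> n k; \<And>k. k < n k; x \<in> X; \<And>k. xs k \<in> X;
       \<And>k p. p < n k \<Longrightarrow> dist ((T ^^ (p + a k)) x) ((T ^^ p) (xs k)) \<le> e1\<rbrakk> \<Longrightarrow>
       eventually (\<lambda>k. \<bar>F (a k + n k) x / (a k + n k) - F (n k) (xs k) / n k\<bar> \<le> \<xi>) sequentially"
    using AAP_tracing[OF F \<open>\<xi> > 0\<close>] by blast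
  obtain e2 where e2: "e2 > 0"
    "\<And>(a :: nat \<Rightarrow> nat) n x xs. \<lbrakk>\<And>k. Suc k * a k \<le> n k; \<And>k. k < n k; x \<in> X; \<And>k. xs k \<in> X;
       \<And>k p. p < n k \<Longrightarrow> dist ((T ^^ (p + a k)) x) ((T ^^ p) (xs k)) \<le> e2\<rbrakk> \<Longrightarrow>
       eventually (\<lambda>k. \<bar>Phi (a k + n k) x / (a k + n k) - Phi (n k) (xs k) / n k\<bar> \<le> \<delta>) sequentially"
    using AAP_tracing[OF Phi \<open>\<delta> > 0\<close>] by blast
  \<comment> \<open>One precision serves both potentials along the same orbit.\<close>
  have "min e1 e2 > 0" using e1(1) e2(1) by simp
  then obtain a n :: "nat \<Rightarrow> nat" where a: "\<And>k. Suc k * a k \<le> n k" and n: "\<And>k. k < n k"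
    and blocks: "\<And>xs :: nat \<Rightarrow> 'a. (\<And>k. xs k \<in> X) \<Longrightarrow>
      \<exists>x\<in>X. \<forall>k. \<forall>p<n k. dist ((T ^^ (p + a k)) x) ((T ^^ p) (xs k)) \<le> min e1 e2"
    using specification_dominating_blocks[OF spec] by metis
  \<comment> \<open>Period 3: \<open>v\<close> makes \<open>Phi\<close> small, \<open>u\<close>
    makes it large, \<open>w\<close> makes \<open>F\<close> large. Each point is chosen for the
    length \<open>n k\<close> of its block.\<close>
  define xs where "xs k = (if k mod 3 = 0 then v (n k) else if k mod 3 = 1 then u (n k) else w (n k))" for k
  have xs: "xs k \<in> X" for k using u(1) v(1) w(1) by (simp add: xs_def)
  obtain x where x: "x \<in> X"
    and tracing: "\<And>k p. p < n k \<Longrightarrow> dist ((T ^^ (p + a k)) x) ((T ^^ p) (xs k)) \<le> min e1 e2"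
    using blocks[of xs] xs by blast
  have F_close: "eventually (\<lambda>k. \<bar>F (a k + n k) x / (a k + n k) - F (n k) (xs k) / n k\<bar> \<le> \<xi>) sequentially"
    by (rule e1(2)[of a n x xs, OF a n x xs]) (use tracing in auto)
  have Phi_close: "eventually (\<lambda>k. \<bar>Phi (a k + n k) x / (a k + n k) - Phi (n k) (xs k) / n k\<bar> \<le> \<delta>) sequentially"
    by (rule e2(2)[of a n x xs, OF a n x xs]) (use tracing in auto)
  have sub: "filterlim (\<lambda>j. 3 * j + i) sequentially sequentially" for i :: nat
    by (rule filterlim_subseq) (simp add: strict_mono_def)
  have n_top: "filterlim n sequentially sequentially"
    by (rule filterlim_at_top_mono[OF filterlim_ident]) (simp add: less_imp_le n)
  have an_top: "filterlim (\<lambda>k. a k + n k) sequentially sequentially"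
    by (rule filterlim_at_top_mono[OF n_top]) simp
  \<comment> \<open>The first fact restricts statements about blocks to a residue class modulo 3;
    the second evaluates statements about lengths at those blocks.\<close>
  note along = eventually_compose_filterlim[OF _ sub] eventually_compose_filterlim[OF _ filterlim_compose[OF n_top sub]]
  have low: "eventually (\<lambda>j. Phi (a (3 * j) + n (3 * j)) x / (a (3 * j) + n (3 * j)) \<le> Fstar Phi M1 + 2 * \<delta>) sequentially"
    using along(1)[OF Phi_close, of 0] along(2)[OF v(2), of 0]
    by eventually_elim (simp add: xs_def)
  have high: "eventually (\<lambda>j. Fstar Phi M2 - 2 * \<delta> \<le>
      Phi (a (3 * j + 1) + n (3 * j + 1)) x / (a (3 * j + 1) + n (3 * j + 1))) sequentially"
    using along(1)[OF Phi_close, of 1] along(2)[OF u(2), of 1]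
  proof eventually_elim
    case (elim j)
    have "xs (3 * j + 1) = u (n (3 * j + 1))" unfolding xs_def by (simp add: mod_Suc)
    then show ?case using elim by simp
  qed
  have large: "eventually (\<lambda>j. c \<le> F (a (3 * j + 2) + n (3 * j + 2)) x / (a (3 * j + 2) + n (3 * j + 2))) sequentially"
    using along(1)[OF F_close, of 2] along(2)[OF w(2), of 2]
  proof eventually_elim
    case (elim j)
    have "xs (3 * j + 2) = w (n (3 * j + 2))" unfolding xs_def by (simp add: mod_Suc)
    then show ?case using elim by simp
  qed
  have "\<not> convergent (\<lambda>n. Phi n x / n)"
  proof
    assume "convergent (\<lambda>n. Phi n x / n)"
    then obtain L where L: "(\<lambda>n. Phi n x / n) \<longlonglongrightarrow> L" unfolding convergent_def by blast
    note L_along = filterlim_compose[OF L filterlim_compose[OF an_top sub]]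
    have "L \<le> Fstar Phi M1 + 2 * \<delta>"
      using tendsto_upperbound[OF L_along[of 0]] low by simp
    moreover have "Fstar Phi M2 - 2 * \<delta> \<le> L"
      using tendsto_lowerbound[OF L_along[of 1]] high by simp
    moreover have "Fstar Phi M2 = Fstar Phi M1 + 5 * \<delta>" by (simp add: \<delta>_def field_simps)
    ultimately show False using \<open>\<delta> > 0\<close> by linarith
  qed
  then have "x \<in> irregular_set X Phi" using x by (simp add: irregular_set_def)
  moreover have "ereal c \<le> limsup (\<lambda>n. ereal (F n x / n))"
  proof (rule ccontr)
    assume "\<not> ereal c \<le> limsup (\<lambda>n. ereal (F n x / n))"
    then have "limsup (\<lambda>n. ereal (F n x / n)) < ereal c" by simp
    then have "eventually (\<lambda>n. ereal (F n x / n) < ereal c) sequentially" by (rule Limsup_lessD)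
    from eventually_compose_filterlim[OF this filterlim_compose[OF an_top sub[of 2]]] large
    have "eventually (\<lambda>j :: nat. False) sequentially" by eventually_elim simp
    then show False by simp
  qed
  ultimately show thesis by (rule that)
qed

end

section \<open>The cycle of inequalities between \<open>beta\<close>, pointwise upper limits and
  limit measures\<close>

theorem theoremD:
  fixes X :: "'a::metric_space set" and T :: "'a \<Rightarrow> 'a"
    and F Phi :: "nat \<Rightarrow> 'a \<Rightarrow> real"
  assumes "compact X" and "X \<noteq> {}" and "T ` X \<subseteq> X" and "continuous_on X T"
    and "spec_property X T"
    and "AAP X T F" and "AAP X T Phi"
    and "eta X T Phi < beta X T Phi"
  shows "beta X T F = (SUP x \<in> irregular_set X Phi. limsup (\<lambda>n. ereal (F n x / real n)))
    \<and> beta X T F = (SUP M \<in> (\<Union>x \<in> irregular_set X Phi. emp_limits X T x). ereal (Fstar F M))"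
proof -
  interpret compact_system X T by unfold_locales fact+
  let ?irr = "irregular_set X Phi"
  let ?pointwise = "SUP x \<in> ?irr. limsup (\<lambda>n. ereal (F n x / real n))"
  let ?measures = "SUP M \<in> (\<Union>x \<in> ?irr. emp_limits X T x). ereal (Fstar F M)"
  have irr: "x \<in> X" if "x \<in> ?irr" for x using that by (simp add: irregular_set_def)
  obtain M1 M2 where M12: "M1 \<in> inv_measures X T" "M2 \<in> inv_measures X T" "Fstar Phi M1 < Fstar Phi M2"
    using \<open>eta X T Phi < beta X T Phi\<close> unfolding eta_def beta_def
    by (auto simp: INF_less_iff less_SUP_iff)
  have "beta X T F \<le> ?pointwise"
    unfolding beta_def
  proof (rule SUP_least)
    fix M assume M: "M \<in> inv_measures X T"
    show "ereal (Fstar F M) \<le> ?pointwise"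
    \<comment> \<open>Staying strictly below the value leaves the margin that tracing consumes. Only
      real \<open>y\<close> need an orbit: plus infinity is excluded and minus infinity is
      trivial.\<close>
    proof (rule dense_le)
      fix y assume y: "y < ereal (Fstar F M)"
      show "y \<le> ?pointwise"
      proof (cases y)
        case (real c)
        then have "c < Fstar F M" using y by simp
        then obtain x where "x \<in> ?irr" "ereal c \<le> limsup (\<lambda>n. ereal (F n x / n))"
          using irregular_point_with_large_limsup[OF assms(5-7) M _ M12] by metis
        then show ?thesis using real by (auto intro: SUP_upper2)
      qed (use y in auto)
    qed
  qed
  moreover have "?pointwise \<le> ?measures"
  proof (rule SUP_least)
    fix x assume x: "x \<in> ?irr"
    obtain M where "M \<in> emp_limits X T x" "ereal (Fstar F M) = limsup (\<lambda>n. ereal (F n x / n))"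
      using limsup_attained_on_emp_limits[OF assms(6) irr[OF x]] by metis
    then show "limsup (\<lambda>n. ereal (F n x / real n)) \<le> ?measures"
      using x by (intro SUP_upper2[of M]) auto
  qed
  moreover have "?measures \<le> beta X T F"
    unfolding beta_def using emp_limits_invariant[OF irr] by (intro SUP_subset_mono) auto
  ultimately show ?thesis by auto
qed

end
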